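(* For all integers $n\geq 5$ and $p\geq 0$, $$\left(\sum_{j=1}^{n-3}(-1)^{j+1}\sum_{i = 0}^{p+2} \binom{p+2}{i} B_{n+i-j-1}\right)\left(\sum_{j=1}^{n-1}(-1)^{j+1}\sum_{i = 0}^{p} \binom{p}{i} B_{n+i-j}\right)<\left(\sum_{j=1}^{n-3}(-1)^{j+1}\sum_{i = 0}^{p+2} \binom{p+2}{i} B_{n+i-j-2}\right)\left(\sum_{j=1}^{n-1}(-1)^{j+1}\sum_{i = 0}^{p} \binom{p}{i} B_{n+i-j+1}\right).$$
   Context: For $n\ge 0$, $B_n$ denotes the $n$-th Bell number, i.e. the number of partitions of a set with $n$ elements ($B_0=B_1=1$, $B_2=2$, $B_3=5$, $B_4=15$, ...). *)

theory Defs
  imports "HOL-Library.Disjoint_Sets"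
begin

definition Bell :: "nat \<Rightarrow> nat" where
  "Bell n = card {P. partition_on {..<n} P}"

end

theory Submission
  imports Defs Complex_Main
begin

text \<open>
  By Dobinski's formula the Bell numbers are, up to the factor \<open>e\<close>, the moments of the weights
  \<open>1 / k!\<close>. Hence the binomial sums insert a factor \<open>(1 + k) ^ p\<close>, the alternating sums are geometric,
  and the four factors are \<open>\<Sum>k b k\<close>, \<open>\<Sum>a k\<close>, \<open>\<Sum>b k\<close>, \<open>\<Sum>k a k\<close> for two nonnegative weights \<open>a\<close>, \<open>b\<close>.
  With \<open>s = (- 1) ^ n\<close>, the ratio of \<open>a\<close> to \<open>b\<close> is
  \<open>(k ^ (n - 1) + s) / ((1 + k)\<^sup>2 (k ^ (n - 3) + s))\<close>, which increases with \<open>k\<close>, so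
  Chebyshev's sum inequality applies.
\<close>

section \<open>Set partitions and Dobinski's formula\<close>

text \<open>A partition is determined by the block containing \<open>a\<close> and the rest:
  \<open>S\<close> is that block without \<open>a\<close>, and the other blocks partition
  \<open>A - S\<close>. This is the Bell recurrence, summed over subsets instead of their
  sizes.\<close>

lemma card_partition_on_insert:
  assumes "finite A" "a \<notin> A"
  shows "card {P. partition_on (insert a A) P} = (\<Sum>S\<in>Pow A. card {P. partition_on (A - S) P})"
proof -
  let ?S = "Sigma (Pow A) (\<lambda>S. {P. partition_on (A - S) P})"
  have "bij_betw (\<lambda>(S, P). insert (insert a S) P) ?S {P. partition_on (insert a A) P}"
    unfolding bij_betw_def
  proof (intro conjI)
    \<comment> \<open>Inverse of the map: no block of \<open>P\<close> contains \<open>a\<close>, so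
      the union runs over the single block \<open>insert a S\<close>.\<close>
    have block: "S = \<Union>{p \<in> insert (insert a S) P. a \<in> p} - {a} \<and> P = {p \<in> insert (insert a S) P. a \<notin> p}"
      if "(S, P) \<in> ?S" for S P
    proof -
      have "S \<subseteq> A" "partition_on (A - S) P" using that by auto
      moreover from this have "\<forall>p\<in>P. a \<notin> p" using assms by (auto simp: partition_on_def)
      ultimately show ?thesis using assms by auto
    qed
    show "inj_on (\<lambda>(S, P). insert (insert a S) P) ?S"
    proof (rule inj_onI, clarify)
      fix S P T Q
      assume "S \<subseteq> A" "partition_on (A - S) P" "T \<subseteq> A" "partition_on (A - T) Q"
        and eq: "insert (insert a S) P = insert (insert a T) Q"
      then have "(S, P) \<in> ?S" "(T, Q) \<in> ?S" by auto
      from block[OF this(1)] block[OF this(2)] eq show "S = T \<and> P = Q" by metis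
    qed
    show "(\<lambda>(S, P). insert (insert a S) P) ` ?S = {P. partition_on (insert a A) P}"
    proof (intro equalityI subsetI)
      fix R assume "R \<in> (\<lambda>(S, P). insert (insert a S) P) ` ?S"
      then obtain S P where "S \<subseteq> A" and P: "partition_on (A - S) P" and R: "R = insert (insert a S) P"
        by auto
      moreover have "disjnt (insert a S) (\<Union>P)" "insert a A - insert a S = A - S"
        using P assms by (auto simp: partition_on_def disjnt_def)
      ultimately show "R \<in> {P. partition_on (insert a A) P}"
        by (auto simp: partition_on_insert)
    next
      fix R assume "R \<in> {P. partition_on (insert a A) P}"
      then have R: "partition_on (insert a A) R" by simp
      then obtain p where p: "p \<in> R" "a \<in> p" by (auto simp: partition_on_def)
      have disj: "disjnt p (\<Union>(R - {p}))"
        using R p by (auto simp: partition_on_def disjoint_def disjnt_def)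
      have "insert p (R - {p}) = R" using p by auto
      with R partition_on_insert[OF disj, of "insert a A"]
      have "partition_on (insert a A - p) (R - {p})" "p \<subseteq> insert a A" by auto
      moreover have "insert a A - p = A - (p - {a})" using p assms by auto
      ultimately have "(p - {a}, R - {p}) \<in> ?S" by auto
      moreover have "R = insert (insert a (p - {a})) (R - {p})" using p by (simp add: insert_absorb)
      ultimately show "R \<in> (\<lambda>(S, P). insert (insert a S) P) ` ?S"
        by (intro image_eqI[where x = "(p - {a}, R - {p})"]) auto
    qed
  qed
  then have "card {P. partition_on (insert a A) P} = card ?S"
    by (simp add: bij_betw_same_card)
  also have "\<dots> = (\<Sum>S\<in>Pow A. card {P. partition_on (A - S) P})"
    using assms by (intro card_SigmaI) (auto intro: finitely_many_partition_on)
  finally show ?thesis .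
qed

text \<open>Expand the product of \<open>1 + x\<close> over \<open>A\<close>, choosing
  \<open>1\<close> on \<open>S\<close> and \<open>x\<close> on \<open>A - S\<close>.\<close>

lemma sum_Pow_power_card_Diff:
  fixes x :: "'a::comm_semiring_1"
  assumes "finite A"
  shows "(\<Sum>S\<in>Pow A. x ^ card (A - S)) = (1 + x) ^ card A"
  using prod_add[OF assms, of "\<lambda>_. 1" "\<lambda>_. x"] by simp

lemma Dobinski_partition_on:
  assumes "finite A"
  shows "(\<lambda>k. real k ^ card A / fact k) sums (exp 1 * real (card {P. partition_on A P}))"
  using assms
proof (induction A rule: finite_psubset_induct)
  case (psubset A)
  show ?case
  proof (cases "A = {}")
    case True
    then show ?thesis using exp_converges[of "1::real"]
      by (simp add: partition_on_empty divide_inverse)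
  next
    case False
    then obtain a C where C: "A = insert a C" "a \<notin> C" by (metis Set.set_insert all_not_in_conv)
    then have fin: "finite C" using psubset.hyps by simp
    have "(\<lambda>k. \<Sum>S\<in>Pow C. real k ^ card (C - S) / fact k) sums
            (\<Sum>S\<in>Pow C. exp 1 * real (card {P. partition_on (C - S) P}))"
      using C by (intro sums_sum psubset.IH) auto
    \<comment> \<open>One factor \<open>Suc k\<close> cancels against the factorial; the remaining
      \<open>(1 + k) ^ card C\<close> expands over subsets, matching the recurrence.\<close>
    also have "(\<lambda>k. \<Sum>S\<in>Pow C. real k ^ card (C - S) / fact k)
                 = (\<lambda>k. real (Suc k) ^ card A / fact (Suc k))"
    proof
      fix k
      have "real (Suc k) ^ card A / fact (Suc k) = real (Suc k) ^ card C / fact k"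
        using C fin by (simp del: of_nat_Suc)
      then show "(\<Sum>S\<in>Pow C. real k ^ card (C - S) / fact k) = real (Suc k) ^ card A / fact (Suc k)"
        using sum_Pow_power_card_Diff[OF fin, of "real k"]
        by (simp add: sum_divide_distrib[symmetric])
    qed
    also have "(\<Sum>S\<in>Pow C. exp 1 * real (card {P. partition_on (C - S) P}))
                 = exp 1 * real (card {P. partition_on A P})"
      using C fin by (simp add: card_partition_on_insert sum_distrib_left)
    \<comment> \<open>The index shift loses only the term at 0, which vanishes because
      \<open>A\<close> is nonempty.\<close>
    finally show ?thesis
      using C fin by (subst (asm) sums_Suc_iff) simp
  qed
qed

lemma Dobinski: "(\<lambda>k. real k ^ n / fact k) sums (exp 1 * real (Bell n))"
  using Dobinski_partition_on[of "{..<n}"] by (simp add: Bell_def)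

section \<open>Alternating sums as moments\<close>

text \<open>The quotient of \<open>x ^ M - (- 1) ^ M\<close> by \<open>1 + x\<close>, kept as a
  polynomial so that Dobinski's formula applies to each monomial.\<close>

definition alt :: "nat \<Rightarrow> real \<Rightarrow> real" where
  "alt M x = (\<Sum>j = 1..M. (- 1) ^ (j + 1) * x ^ (M - j))"

lemma alt_Suc: "alt (Suc M) x = x ^ M - alt M x"
proof -
  have "alt (Suc M) x = (\<Sum>j = 0..M. (- 1) ^ j * x ^ (M - j))"
    unfolding alt_def using sum.shift_bounds_cl_Suc_ivl[of "\<lambda>j. (- 1) ^ (j + 1) * x ^ (Suc M - j)" 0 M]
    by simp
  also have "\<dots> = x ^ M + (\<Sum>j = 1..M. (- 1) ^ j * x ^ (M - j))"
    by (simp add: sum.atLeast_Suc_atMost)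
  finally show ?thesis by (simp add: alt_def sum_negf)
qed

lemma alt_closed: "(1 + x) * alt M x = x ^ M - (- 1) ^ M"
proof (induction M)
  case 0
  then show ?case by (simp add: alt_def)
next
  case (Suc M)
  have "(1 + x) * alt (Suc M) x = (1 + x) * x ^ M - (1 + x) * alt M x"
    by (simp add: alt_Suc algebra_simps)
  also have "\<dots> = (1 + x) * x ^ M - (x ^ M - (- 1) ^ M)" by (simp only: Suc)
  finally show ?case by (simp add: algebra_simps)
qed

lemma alternating_Bell_sums:
  "(\<lambda>k. real k ^ r * (1 + real k) ^ q * alt M (real k) / fact k) sums
     (exp 1 * real_of_int (\<Sum>j = 1..M. (- 1) ^ (j + 1) *
        (\<Sum>i = 0..q. int (q choose i) * int (Bell (M + i - j + r)))))"
proof -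
  have "(\<lambda>k. \<Sum>j = 1..M. (- 1) ^ (j + 1) *
            (\<Sum>i = 0..q. real (q choose i) * (real k ^ (M + i - j + r) / fact k))) sums
          (\<Sum>j = 1..M. (- 1) ^ (j + 1) *
            (\<Sum>i = 0..q. real (q choose i) * (exp 1 * real (Bell (M + i - j + r)))))"
    by (intro sums_sum sums_mult Dobinski)
  also have "(\<lambda>k. \<Sum>j = 1..M. (- 1) ^ (j + 1) *
               (\<Sum>i = 0..q. real (q choose i) * (real k ^ (M + i - j + r) / fact k)))
             = (\<lambda>k. real k ^ r * (1 + real k) ^ q * alt M (real k) / fact k)"
  proof
    fix k
    have "(\<Sum>i = 0..q. real (q choose i) * (real k ^ (M + i - j + r) / fact k))
            = real k ^ (M - j) * (real k ^ r * (1 + real k) ^ q / fact k)" if "j \<in> {1..M}" for j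
    proof -
      have "real k ^ (M + i - j + r) = real k ^ (M - j) * real k ^ r * real k ^ i" for i
      proof -
        \<comment> \<open>Truncated subtraction is harmless here because
          \<open>j \<le> M\<close>.\<close>
        have "M + i - j + r = (M - j) + r + i" using that by simp
        then show ?thesis by (simp only: power_add)
      qed
      moreover have "(1 + real k) ^ q = (\<Sum>i = 0..q. real (q choose i) * real k ^ i)"
        using binomial_ring[of "real k" 1 q] by (simp add: add.commute atLeast0AtMost)
      ultimately show ?thesis by (simp add: sum_distrib_left sum_divide_distrib mult_ac)
    qed
    then show "(\<Sum>j = 1..M. (- 1) ^ (j + 1) *
            (\<Sum>i = 0..q. real (q choose i) * (real k ^ (M + i - j + r) / fact k)))
          = real k ^ r * (1 + real k) ^ q * alt M (real k) / fact k"
      by (simp add: alt_def sum_distrib_left sum_distrib_right sum_divide_distrib mult_ac)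
  qed
  finally show ?thesis
    by (simp add: sum_distrib_left mult_ac)
qed

section \<open>Chebyshev's sum inequality for series\<close>

text \<open>Symmetrizing writes twice the difference as a double sum of terms \<open>t x y\<close>,
  each nonnegative because its two factors change sign together. Monotonicity of
  \<open>a / b\<close> is cross-multiplied since \<open>b\<close> may vanish.\<close>

lemma Chebyshev_sums_less:
  fixes a b :: "nat \<Rightarrow> real"
  assumes "a sums A" "b sums B" "(\<lambda>k. real k * a k) sums A'" "(\<lambda>k. real k * b k) sums B'"
    and le: "\<And>x y. x < y \<Longrightarrow> a x * b y \<le> a y * b x"
    and less: "x0 < y0" "a x0 * b y0 < a y0 * b x0"
  shows "B' * A < B * A'"
proof -
  define t where "t x y = (real y - real x) * (a y * b x - a x * b y)" for x y
  have t_nonneg: "t x y \<ge> 0" for x y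
  proof (cases x y rule: linorder_cases)
    case less
    then show ?thesis using le[of x y] by (simp add: t_def)
  next
    case greater
    then show ?thesis using le[of y x] by (simp add: t_def mult_nonpos_nonpos)
  qed (simp add: t_def)
  have t_pos: "t x0 y0 > 0" using less by (simp add: t_def)
  let ?s = "\<lambda>f N. \<Sum>k<N. f k :: real"
  have double: "2 * (?s b N * ?s (\<lambda>k. real k * a k) N - ?s (\<lambda>k. real k * b k) N * ?s a N)
           = (\<Sum>x<N. \<Sum>y<N. t x y)" for N
  proof -
    define u where "u x y = b x * (real y * a y) - real x * b x * a y" for x y
    have "(\<Sum>x<N. \<Sum>y<N. u x y)
        = ?s b N * ?s (\<lambda>k. real k * a k) N - ?s (\<lambda>k. real k * b k) N * ?s a N"
      by (simp add: u_def sum_product sum_subtractf)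
    moreover have "(\<Sum>x<N. \<Sum>y<N. u y x) = (\<Sum>x<N. \<Sum>y<N. u x y)"
      by (rule sum.swap)
    moreover have "t x y = u x y + u y x" for x y
      by (simp add: t_def u_def algebra_simps)
    ultimately show ?thesis by (simp add: sum.distrib)
  qed
  \<comment> \<open>A fixed positive lower bound on the partial sums keeps the inequality strict in
    the limit.\<close>
  have "t x0 y0 \<le> 2 * (?s b N * ?s (\<lambda>k. real k * a k) N - ?s (\<lambda>k. real k * b k) N * ?s a N)"
    if "N \<ge> Suc y0" for N
  proof -
    have "t x0 y0 \<le> (\<Sum>y<N. t x0 y)"
      using that t_nonneg by (intro member_le_sum) auto
    also have "\<dots> \<le> (\<Sum>x<N. \<Sum>y<N. t x y)"
      using that t_nonneg less
      by (intro member_le_sum[where f = "\<lambda>x. \<Sum>y<N. t x y"]) (auto intro: sum_nonneg)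
    finally show ?thesis using double by simp
  qed
  moreover have "(\<lambda>N. 2 * (?s b N * ?s (\<lambda>k. real k * a k) N - ?s (\<lambda>k. real k * b k) N * ?s a N))
                   \<longlonglongrightarrow> 2 * (B * A' - B' * A)"
    using assms(1-4) unfolding sums_def by (intro tendsto_intros)
  ultimately have "t x0 y0 \<le> 2 * (B * A' - B' * A)"
    by (intro LIMSEQ_le_const) auto
  with t_pos show ?thesis by simp
qed

section \<open>Monotonicity of the ratio of the weights\<close>

text \<open>
  Writing \<open>u = x ^ m + s\<close> and \<open>v = y ^ m + s\<close>, the difference of the two sides is
  \<open>u v (y - x) (x + y + 2 x y) - s (1 + x) (1 + y) ((y - 1) (1 + x) u - (x - 1) (1 + y) v)\<close>;
  its first term dominates the one negative summand because \<open>u \<ge> x\<^sup>2 + s\<close> and \<open>v \<ge> y\<^sup>2 + s\<close>.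
\<close>

lemma ratio_cross_identity:
  fixes x y s :: real
  shows "(y ^ (m + 2) + s) * ((1 + x)\<^sup>2 * (x ^ m + s)) - (x ^ (m + 2) + s) * ((1 + y)\<^sup>2 * (y ^ m + s))
    = (x ^ m + s) * (y ^ m + s) * ((y - x) * (x + y + 2 * x * y))
      - s * ((1 + x) * (1 + y) * ((y - 1) * (1 + x) * (x ^ m + s) - (x - 1) * (1 + y) * (y ^ m + s)))"
proof -
  define X Y where "X = x ^ m" and "Y = y ^ m"
  have eqs: "x ^ (m + 2) = x\<^sup>2 * X" "y ^ (m + 2) = y\<^sup>2 * Y"
    by (simp_all only: X_def Y_def power_add mult.commute)
  show ?thesis
    unfolding eqs X_def[symmetric] Y_def[symmetric] by algebra
qed

lemma ratio_plus_less:
  fixes x y :: real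
  assumes "1 \<le> x" "x + 1 \<le> y" "2 \<le> m"
  shows "(x ^ (m + 2) + 1) * ((1 + y)\<^sup>2 * (y ^ m + 1)) < (y ^ (m + 2) + 1) * ((1 + x)\<^sup>2 * (x ^ m + 1))"
proof -
  define u v where "u = x ^ m + 1" and "v = y ^ m + 1"
  have u: "u > 0" using assms by (simp add: u_def add_pos_pos)
  have "y\<^sup>2 \<le> y ^ m" using assms by (intro power_increasing) auto
  then have v: "v > y\<^sup>2 - 1" by (simp add: v_def)
  have y: "y\<^sup>2 > 1" using assms by (simp add: one_less_power)
  \<comment> \<open>For \<open>s = 1\<close> the negative summand is
    \<open>u * (y\<^sup>2 - 1) * (1 + x)\<^sup>2\<close>; this bound and
    \<open>v > y\<^sup>2 - 1\<close> dominate it.\<close>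
  have pos: "(y - x) * (x + y + 2 * x * y) \<ge> (1 + x)\<^sup>2"
  proof -
    have "1 * (x + (x + 1) + 2 * x * (x + 1)) \<le> (y - x) * (x + y + 2 * x * y)"
      using assms by (intro mult_mono add_mono) auto
    moreover have "(1 + x)\<^sup>2 \<le> x + (x + 1) + 2 * x * (x + 1)"
      using assms by (simp add: power2_eq_square algebra_simps)
    ultimately show ?thesis by simp
  qed
  have "(y\<^sup>2 - 1) * (1 + x)\<^sup>2 < v * (1 + x)\<^sup>2"
    using v assms by (intro mult_strict_right_mono) auto
  also have "\<dots> \<le> v * ((y - x) * (x + y + 2 * x * y))"
    using pos v y by (intro mult_left_mono) auto
  finally have "u * ((y\<^sup>2 - 1) * (1 + x)\<^sup>2) < u * (v * ((y - x) * (x + y + 2 * x * y)))"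
    using u by simp
  moreover have "(1 + x) * (1 + y) * ((x - 1) * (1 + y) * v) \<ge> 0"
    using assms v y by (intro mult_nonneg_nonneg) linarith+
  ultimately show ?thesis
    using ratio_cross_identity[where s = 1, of y m x] unfolding u_def v_def
    by (simp add: power2_eq_square algebra_simps)
qed

text \<open>For \<open>s = - 1\<close> the roles swap: the negative summand is
  \<open>v * (x\<^sup>2 - 1) * (1 + y)\<^sup>2\<close>, and \<open>u\<close> is bounded below. At
  \<open>x = 1\<close> both sides would be 0, hence \<open>2 \<le> x\<close>.\<close>

lemma ratio_minus_less:
  fixes x y :: real
  assumes "2 \<le> x" "x + 1 \<le> y" "2 \<le> m"
  shows "(x ^ (m + 2) - 1) * ((1 + y)\<^sup>2 * (y ^ m - 1)) < (y ^ (m + 2) - 1) * ((1 + x)\<^sup>2 * (x ^ m - 1))"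
proof -
  define u v where "u = x ^ m - 1" and "v = y ^ m - 1"
  have "x\<^sup>2 \<le> x ^ m" using assms by (intro power_increasing) auto
  then have u: "u \<ge> x\<^sup>2 - 1" by (simp add: u_def)
  have x: "x\<^sup>2 > 3" using power_mono[of 2 x 2] assms by simp
  have v: "v > 0" using assms by (simp add: v_def one_less_power)
  have pos: "(y - x) * (x + y + 2 * x * y) > (1 + y)\<^sup>2"
  proof -
    have "x * 1 \<le> x * (y - x)"
      using assms by (intro mult_left_mono) auto
    then have "2 * (x + 1) * (x - 1) \<le> 2 * y * (x * (y - x) - 1)"
      using assms by (intro mult_mono) auto
    \<comment> \<open>The left side equals \<open>x\<^sup>2 - 3\<close>.\<close>
    moreover have "2 * (x + 1) * (x - 1) - (x\<^sup>2 + 1) > 0"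
      using x by (simp add: power2_eq_square algebra_simps)
    moreover have "(y - x) * (x + y + 2 * x * y) - (1 + y)\<^sup>2 = 2 * y * (x * (y - x) - 1) - (x\<^sup>2 + 1)"
      by (simp add: power2_eq_square algebra_simps)
    ultimately show ?thesis by linarith
  qed
  have "(x\<^sup>2 - 1) * (1 + y)\<^sup>2 < (x\<^sup>2 - 1) * ((y - x) * (x + y + 2 * x * y))"
    using pos x by (intro mult_strict_left_mono) auto
  also have "\<dots> \<le> u * ((y - x) * (x + y + 2 * x * y))"
    using u assms by (intro mult_right_mono) auto
  finally have "v * ((x\<^sup>2 - 1) * (1 + y)\<^sup>2) < v * (u * ((y - x) * (x + y + 2 * x * y)))"
    using v by simp
  moreover have "(1 + x) * (1 + y) * ((y - 1) * (1 + x) * u) \<ge> 0"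
    using assms u x by (intro mult_nonneg_nonneg) auto
  ultimately show ?thesis
    using ratio_cross_identity[where s = "- 1", of y m x] unfolding u_def v_def
    by (simp add: power2_eq_square algebra_simps)
qed

text \<open>Multiplying by \<open>(1 + x) * (1 + y)\<close> gives closed forms with
  \<open>s = - ((- 1) ^ m)\<close>, so the parity of \<open>m\<close> selects the case.\<close>

lemma alt_cross_less:
  fixes x y :: nat
  assumes "1 \<le> x" "x < y" "2 \<le> m" "odd m \<or> 2 \<le> x"
  shows "alt (m + 2) x * ((1 + real y)\<^sup>2 * alt m y) < alt (m + 2) y * ((1 + real x)\<^sup>2 * alt m x)"
proof -
  let ?e = "(- 1 :: real) ^ m"
  have xy: "real x + 1 \<le> real y" using assms by linarith
  have "(real x ^ (m + 2) - ?e) * ((1 + real y)\<^sup>2 * (real y ^ m - ?e))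
        < (real y ^ (m + 2) - ?e) * ((1 + real x)\<^sup>2 * (real x ^ m - ?e))"
  proof (cases "odd m")
    case True
    then show ?thesis using ratio_plus_less[of x y m] assms xy by simp
  next
    case False
    then show ?thesis using ratio_minus_less[of x y m] assms xy by simp
  qed
  moreover have "((1 + real x) * (1 + real y)) * (alt (m + 2) x * ((1 + real y)\<^sup>2 * alt m y))
      = (real x ^ (m + 2) - ?e) * ((1 + real y)\<^sup>2 * (real y ^ m - ?e))" for x y :: nat
  proof -
    have "((1 + real x) * (1 + real y)) * (alt (m + 2) x * ((1 + real y)\<^sup>2 * alt m y))
        = ((1 + real x) * alt (m + 2) x) * ((1 + real y)\<^sup>2 * ((1 + real y) * alt m y))"
      by (simp only: mult_ac)
    then show ?thesis by (simp only: alt_closed) simp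
  qed
  ultimately have "((1 + real x) * (1 + real y)) * (alt (m + 2) x * ((1 + real y)\<^sup>2 * alt m y))
        < ((1 + real x) * (1 + real y)) * (alt (m + 2) y * ((1 + real x)\<^sup>2 * alt m x))"
    by (metis mult.commute)
  then show ?thesis by (simp add: mult_less_cancel_left_pos)
qed

section \<open>The Bell number inequality\<close>

theorem corollary23:
  fixes n p :: nat
  assumes "n \<ge> 5"
  shows "(\<Sum>j = 1..n - 3. (- 1) ^ (j + 1) * (\<Sum>i = 0..p + 2. int ((p + 2) choose i) * int (Bell (n + i - j - 1)))) *
         (\<Sum>j = 1..n - 1. (- 1) ^ (j + 1) * (\<Sum>i = 0..p. int (p choose i) * int (Bell (n + i - j)))) <
         (\<Sum>j = 1..n - 3. (- 1) ^ (j + 1) * (\<Sum>i = 0..p + 2. int ((p + 2) choose i) * int (Bell (n + i - j - 2)))) *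
         (\<Sum>j = 1..n - 1. (- 1) ^ (j + 1) * (\<Sum>i = 0..p. int (p choose i) * int (Bell (n + i - j + 1))))"
proof -
  define m where "m = n - 3"
  have m: "2 \<le> m" "n = m + 3" using assms by (auto simp: m_def)
  \<comment> \<open>Both weights carry one factor \<open>k\<close> (\<open>r = 1\<close>); one more
    factor \<open>k\<close> gives the sums with \<open>r = 2\<close>.\<close>
  define a where "a k = real k ^ 1 * (1 + real k) ^ p * alt (m + 2) (real k) / fact k" for k
  define b where "b k = real k ^ 1 * (1 + real k) ^ (p + 2) * alt m (real k) / fact k" for k
  define S where "S r q M = (\<Sum>j = 1..M. (- 1) ^ (j + 1) *
        (\<Sum>i = 0..q. int (q choose i) * int (Bell (M + i - j + r))))" for r q M
  have cross: "a x * b y < a y * b x" if "1 \<le> x" "x < y" "odd m \<or> 2 \<le> x" for x y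
  proof -
    define c where "c = real x * real y * ((1 + real x) * (1 + real y)) ^ p / (fact x * fact y)"
    have "c > 0" using that by (simp add: c_def)
    with alt_cross_less[OF that(1,2) m(1) that(3)]
    have "c * (alt (m + 2) x * ((1 + real y)\<^sup>2 * alt m y)) < c * (alt (m + 2) y * ((1 + real x)\<^sup>2 * alt m x))"
      by simp
    then show ?thesis
      by (simp add: a_def b_def c_def power_mult_distrib power2_eq_square mult_ac)
  qed
  have "real_of_int (S 2 (p + 2) m) * exp 1 * (real_of_int (S 1 p (m + 2)) * exp 1)
      < real_of_int (S 1 (p + 2) m) * exp 1 * (real_of_int (S 2 p (m + 2)) * exp 1)"
  proof (rule Chebyshev_sums_less)
    show "a sums (real_of_int (S 1 p (m + 2)) * exp 1)"
      using alternating_Bell_sums[of 1 p "m + 2"] unfolding a_def S_def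
      by (subst mult.commute[of _ "exp 1"])
    show "b sums (real_of_int (S 1 (p + 2) m) * exp 1)"
      using alternating_Bell_sums[of 1 "p + 2" m] unfolding b_def S_def
      by (subst mult.commute[of _ "exp 1"])
    show "(\<lambda>k. real k * a k) sums (real_of_int (S 2 p (m + 2)) * exp 1)"
      using alternating_Bell_sums[of 2 p "m + 2"]
      by (simp add: a_def S_def power2_eq_square mult_ac)
    show "(\<lambda>k. real k * b k) sums (real_of_int (S 2 (p + 2) m) * exp 1)"
      using alternating_Bell_sums[of 2 "p + 2" m]
      by (simp add: b_def S_def power2_eq_square mult_ac)
    show "a x * b y \<le> a y * b x" if "x < y" for x y
    proof -
      \<comment> \<open>Both weights vanish at 0 through the factor \<open>k\<close>, and at 1 for
        even \<open>m\<close> through \<open>alt\<close>; elsewhere the strict comparison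
        holds.\<close>
      consider "x = 0" | "x = 1" "even m" | "1 \<le> x" "odd m \<or> 2 \<le> x" by linarith
      then show ?thesis
      proof cases
        case 2
        then have "alt m (real x) = 0" "alt (m + 2) (real x) = 0"
          using alt_closed[of 1 m] alt_closed[of 1 "m + 2"] by auto
        then show ?thesis by (simp add: a_def b_def)
      next
        case 3
        then show ?thesis using cross[OF 3(1) that 3(2)] by simp
      qed (simp add: a_def b_def)
    qed
    \<comment> \<open>The pair 2, 3 gives strictness for either parity of \<open>m\<close>.\<close>
    show "(2::nat) < 3" "a 2 * b 3 < a 3 * b 2" using cross[of 2 3] by simp_all
  qed
  then have "exp 1 * exp 1 * real_of_int (S 2 (p + 2) m * S 1 p (m + 2))
      < exp 1 * exp 1 * real_of_int (S 1 (p + 2) m * S 2 p (m + 2))"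
    by (simp add: mult_ac)
  then have "S 2 (p + 2) m * S 1 p (m + 2) < S 1 (p + 2) m * S 2 p (m + 2)"
    by (simp only: mult_less_cancel_left_pos exp_gt_zero mult_pos_pos of_int_less_iff)
  \<comment> \<open>The indices agree under \<open>n = m + 3\<close>, since \<open>j\<close> never
    exceeds the upper summation bound.\<close>
  moreover have "S 2 (p + 2) m = (\<Sum>j = 1..n - 3. (- 1) ^ (j + 1) *
      (\<Sum>i = 0..p + 2. int ((p + 2) choose i) * int (Bell (n + i - j - 1))))"
    and "S 1 (p + 2) m = (\<Sum>j = 1..n - 3. (- 1) ^ (j + 1) *
      (\<Sum>i = 0..p + 2. int ((p + 2) choose i) * int (Bell (n + i - j - 2))))"
    and "S 1 p (m + 2) = (\<Sum>j = 1..n - 1. (- 1) ^ (j + 1) *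
      (\<Sum>i = 0..p. int (p choose i) * int (Bell (n + i - j))))"
    and "S 2 p (m + 2) = (\<Sum>j = 1..n - 1. (- 1) ^ (j + 1) *
      (\<Sum>i = 0..p. int (p choose i) * int (Bell (n + i - j + 1))))"
    unfolding S_def m(2)
    by (intro sum.cong arg_cong2[where f = "(*)"] arg_cong[where f = int] arg_cong[where f = Bell] refl; auto)+
  ultimately show ?thesis by (simp only:)
qed

end
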